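(* For every $\alpha \in (0,1)$ there exists a strictly ergodic subshift $X$ (over a finite alphabet, with the shift map $\sigma$) whose topological entropy dimension equals $\alpha$.
   Context: A subshift is a closed shift-invariant subset $X$ of $\mathcal{A}^{\mathbb{Z}}$ for a finite alphabet $\mathcal{A}$, with the left shift $\sigma$. It is strictly ergodic if it is minimal and uniquely ergodic. Let $\mathcal{B}_n(X)$ be the set of words of length $n$ occurring in points of $X$. The topological upper (resp. lower) entropy dimension of $X$ is the unique value $c\in[0,\infty]$ such that $\limsup_{n\to\infty} \frac{\log|\mathcal{B}_n(X)|}{n^{\beta}}$ (resp. with $\liminf$) equals $\infty$ for all $0<\beta<c$ and equals $0$ for all $\beta > c$. If the upper and lower entropy dimensions coincide, the common value is the topological entropy dimension of $X$. *)

theory Defs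
  imports "HOL-Probability.Probability"
begin

text \<open>Points of the full shift are maps \<open>int \<Rightarrow> nat\<close>; the finite alphabet is a finite
  set \<open>A :: nat set\<close> (nat carries the discrete topology), and the space \<open>int \<Rightarrow> nat\<close>
  carries the product topology.\<close>

definition shift :: "(int \<Rightarrow> nat) \<Rightarrow> (int \<Rightarrow> nat)" where
  "shift x = (\<lambda>i. x (i + 1))"

definition is_subshift :: "nat set \<Rightarrow> (int \<Rightarrow> nat) set \<Rightarrow> bool" where
  "is_subshift A X \<longleftrightarrow> finite A \<and> X \<subseteq> {x. \<forall>i. x i \<in> A} \<and> closed X \<and> shift ` X = X"

definition minimal_subshift :: "(int \<Rightarrow> nat) set \<Rightarrow> bool" where
  "minimal_subshift X \<longleftrightarrow> X \<noteq> {} \<and>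
     (\<forall>Y. Y \<subseteq> X \<and> Y \<noteq> {} \<and> closed Y \<and> shift ` Y = Y \<longrightarrow> Y = X)"

definition invariant_measure :: "(int \<Rightarrow> nat) set \<Rightarrow> (int \<Rightarrow> nat) measure \<Rightarrow> bool" where
  "invariant_measure X M \<longleftrightarrow> sets M = sets borel \<and> prob_space M \<and> emeasure M X = 1 \<and>
     distr M M shift = M"

definition uniquely_ergodic :: "(int \<Rightarrow> nat) set \<Rightarrow> bool" where
  "uniquely_ergodic X \<longleftrightarrow> (\<exists>!M. invariant_measure X M)"

definition strictly_ergodic :: "(int \<Rightarrow> nat) set \<Rightarrow> bool" where
  "strictly_ergodic X \<longleftrightarrow> minimal_subshift X \<and> uniquely_ergodic X"

definition words :: "(int \<Rightarrow> nat) set \<Rightarrow> nat \<Rightarrow> nat list set" where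
  "words X n = {map (\<lambda>i. x (m + int i)) [0..<n] | x m. x \<in> X}"

definition upper_entropy_dim :: "(int \<Rightarrow> nat) set \<Rightarrow> ereal \<Rightarrow> bool" where
  "upper_entropy_dim X c \<longleftrightarrow> 0 \<le> c \<and>
     (\<forall>\<beta>::real. 0 < \<beta> \<and> ereal \<beta> < c \<longrightarrow>
        limsup (\<lambda>n. ereal (ln (real (card (words X n))) / real n powr \<beta>)) = \<infinity>) \<and>
     (\<forall>\<beta>::real. 0 < \<beta> \<and> c < ereal \<beta> \<longrightarrow>
        limsup (\<lambda>n. ereal (ln (real (card (words X n))) / real n powr \<beta>)) = 0)"

definition lower_entropy_dim :: "(int \<Rightarrow> nat) set \<Rightarrow> ereal \<Rightarrow> bool" where
  "lower_entropy_dim X c \<longleftrightarrow> 0 \<le> c \<and>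
     (\<forall>\<beta>::real. 0 < \<beta> \<and> ereal \<beta> < c \<longrightarrow>
        liminf (\<lambda>n. ereal (ln (real (card (words X n))) / real n powr \<beta>)) = \<infinity>) \<and>
     (\<forall>\<beta>::real. 0 < \<beta> \<and> c < ereal \<beta> \<longrightarrow>
        liminf (\<lambda>n. ereal (ln (real (card (words X n))) / real n powr \<beta>)) = 0)"

definition entropy_dim :: "(int \<Rightarrow> nat) set \<Rightarrow> ereal \<Rightarrow> bool" where
  "entropy_dim X c \<longleftrightarrow> upper_entropy_dim X c \<and> lower_entropy_dim X c"

end

theory Submission
  imports Defs "HOL-Library.Sublist" "HOL-Real_Asymp.Real_Asymp"
begin

text \<open>
  Build sets of binary words $W_k$ of length $2^k$. At a free level, $W_{k+1}$ consists of all
  concatenations $vw$ with $v, w \in W_k$; at a frozen level it consists of the words $vF_k$ with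
  $v \in W_k$, for one fixed $F_k \in W_k$. If $h$ of the levels below $k$ are free, then
  $|W_k| = 2^{2^h}$, so taking $h = \lfloor \alpha k \rfloor$ gives
  $\log |W_k| \approx (2^k)^\alpha$. The subshift $X$ consists of the sequences which, for every
  $k$, are concatenations of words of $W_k$; it is nonempty by compactness.

  \<^item> Minimality: the $F_k$ are chosen so that every word of every $W_j$ occurs in some $F_k$ and
    hence in every point of $X$. At a free level any two consecutive blocks form a block, so each
    word of a point of $X$ lies inside a single block.
  \<^item> Unique ergodicity: as in a regular Toeplitz sequence, the words of $W_k$ agree off $2^h$
    positions, a vanishing proportion of $2^k$. Hence the frequencies of a cylinder set along
    orbit segments of length $2^k$ converge to a constant on $X$.
  \<^item> Existence of the measure: these limit frequencies are a finitely additive shift-invariant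
    content on the algebra of cylinder sets, countably additive because $X$ is compact.
\<close>

section \<open>Cylinder sets in the space of two-sided sequences\<close>

text \<open>For fixed \<open>n\<close> these are the classes of an equivalence relation, so they
  partition the space into clopen sets; they shrink as \<open>n\<close> grows.\<close>

definition window :: "nat \<Rightarrow> (int \<Rightarrow> nat) \<Rightarrow> (int \<Rightarrow> nat) set" where
  "window n x = {y. \<forall>i. \<bar>i\<bar> \<le> int n \<longrightarrow> y i = x i}"

text \<open>One \<open>n\<close> has to serve all points of \<open>C\<close>. This uniformity makes
  the family closed under complement, which open sets in general are not.\<close>

definition cylinder_sets :: "(int \<Rightarrow> nat) set set" where
  "cylinder_sets = {C. \<exists>n. \<forall>x\<in>C. window n x \<subseteq> C}"

lemma window_self [simp]: "x \<in> window n x"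
  by (simp add: window_def)

lemma window_sym: "y \<in> window n x \<longleftrightarrow> x \<in> window n y"
  unfolding window_def mem_Collect_eq by metis

lemma window_trans: "y \<in> window n x \<Longrightarrow> window n y = window n x"
  unfolding window_def mem_Collect_eq by (intro Collect_cong) metis

lemma window_antimono: "m \<le> n \<Longrightarrow> window n x \<subseteq> window m x"
  by (auto simp: window_def)

lemma open_window: "open (window n x)"
proof -
  have "window n x = {y. \<forall>i\<in>{- int n..int n}. y (id i) \<in> {x i}}"
    by (auto simp: window_def abs_le_iff)
  moreover have "open {y. \<forall>i\<in>{- int n..int n}. y (id i) \<in> {x i}}"
    by (rule product_topology_basis') (auto intro: discrete_topology_class.open_discrete)
  ultimately show ?thesis by simp
qed

text \<open>A basic open box constrains only finitely many coordinates, and a window reaching the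
  farthest of them fixes them all.\<close>

lemma open_contains_window:
  assumes "open U" "x \<in> U"
  obtains n where "window n x \<subseteq> U"
proof -
  from assms have "openin (product_topology (\<lambda>i. euclidean) UNIV) U"
    by (simp add: open_fun_def)
  from product_topology_open_contains_basis[OF this \<open>x \<in> U\<close>]
  obtain B where B: "x \<in> Pi\<^sub>E UNIV B" "finite {i. B i \<noteq> UNIV}" "Pi\<^sub>E UNIV B \<subseteq> U"
    by auto
  \<comment> \<open>The inserted \<open>0\<close> keeps \<open>Max\<close> meaningful when no
    coordinate is constrained.\<close>
  define n where "n = Max (insert 0 ((\<lambda>i. nat \<bar>i\<bar>) ` {i. B i \<noteq> UNIV}))"
  have n: "\<bar>i\<bar> \<le> int n" if "B i \<noteq> UNIV" for i
  proof -
    have "nat \<bar>i\<bar> \<le> n"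
      unfolding n_def using B(2) that by (intro Max_ge) auto
    then show ?thesis by linarith
  qed
  have "window n x \<subseteq> Pi\<^sub>E UNIV B"
  proof
    fix y assume y: "y \<in> window n x"
    have "y i \<in> B i" for i
      using y n[of i] B(1) by (cases "B i = UNIV") (auto simp: window_def PiE_iff)
    then show "y \<in> Pi\<^sub>E UNIV B" by auto
  qed
  with B(3) show ?thesis by (intro that[of n]) (rule order_trans)
qed

lemma closed_window_iff:
  "closed X \<longleftrightarrow> (\<forall>x. (\<forall>n. window n x \<inter> X \<noteq> {}) \<longrightarrow> x \<in> X)"
proof (intro iffI allI impI)
  fix x assume "closed X" and x: "\<forall>n. window n x \<inter> X \<noteq> {}"
  show "x \<in> X"
  proof (rule ccontr)
    assume "x \<notin> X"
    with \<open>closed X\<close> obtain n where "window n x \<subseteq> - X"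
      using open_contains_window[of "- X" x] by (auto simp: closed_def)
    with x show False by blast
  qed
next
  assume *: "\<forall>x. (\<forall>n. window n x \<inter> X \<noteq> {}) \<longrightarrow> x \<in> X"
  have "\<exists>T. open T \<and> x \<in> T \<and> T \<subseteq> - X" if "x \<in> - X" for x
  proof -
    from that * obtain n where "window n x \<inter> X = {}" by blast
    then show ?thesis
      by (intro exI[of _ "window n x"]) (auto simp: open_window)
  qed
  then show "closed X" by (auto simp: closed_def open_subopen[of "- X"])
qed

section \<open>The algebra of cylinder sets\<close>

lemma cylinder_sets_Compl:
  assumes "C \<in> cylinder_sets" shows "- C \<in> cylinder_sets"
proof -
  obtain n where n: "\<forall>x\<in>C. window n x \<subseteq> C"
    using assms unfolding cylinder_sets_def by blast
  have "\<forall>x\<in>- C. window n x \<subseteq> - C"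
  proof (intro ballI subsetI ComplI notI)
    fix x y assume "x \<in> - C" "y \<in> window n x" "y \<in> C"
    with n window_sym[of y n x] show False by blast
  qed
  then show ?thesis unfolding cylinder_sets_def by blast
qed

lemma cylinder_sets_Int:
  assumes "C \<in> cylinder_sets" "D \<in> cylinder_sets"
  shows "C \<inter> D \<in> cylinder_sets"
proof -
  obtain m n where "\<forall>x\<in>C. window m x \<subseteq> C" "\<forall>x\<in>D. window n x \<subseteq> D"
    using assms unfolding cylinder_sets_def by blast
  then have "\<forall>x\<in>C \<inter> D. window (max m n) x \<subseteq> C \<inter> D"
    by (meson IntD1 IntD2 Int_subset_iff max.cobounded1 max.cobounded2 order_trans window_antimono)
  then show ?thesis unfolding cylinder_sets_def by blast
qed

lemma UNIV_cylinder_sets [simp]: "UNIV \<in> cylinder_sets"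
  by (simp add: cylinder_sets_def)

lemma algebra_cylinder_sets: "algebra UNIV cylinder_sets"
  unfolding algebra_iff_Int Compl_eq_Diff_UNIV[symmetric]
  by (intro conjI ballI cylinder_sets_Int cylinder_sets_Compl)
    (use cylinder_sets_Compl[OF UNIV_cylinder_sets] in simp_all)

lemma cylinder_sets_open:
  assumes "C \<in> cylinder_sets" shows "open C"
proof -
  obtain n where n: "\<forall>x\<in>C. window n x \<subseteq> C"
    using assms unfolding cylinder_sets_def by blast
  have "\<exists>T. open T \<and> x \<in> T \<and> T \<subseteq> C" if "x \<in> C" for x
    using n that by (intro exI[of _ "window n x"]) (auto simp: open_window)
  then show ?thesis by (simp add: open_subopen[of C])
qed

lemma cylinder_sets_closed: "C \<in> cylinder_sets \<Longrightarrow> closed C"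
  by (simp add: closed_def cylinder_sets_open cylinder_sets_Compl)

lemma window_cylinder: "window n x \<in> cylinder_sets"
proof -
  have "\<forall>y\<in>window n x. window n y \<subseteq> window n x" by (simp add: window_trans)
  then show ?thesis unfolding cylinder_sets_def by blast
qed

lemma cylinder_sets_shift:
  assumes "C \<in> cylinder_sets" shows "shift -` C \<in> cylinder_sets"
proof -
  obtain n where n: "\<forall>x\<in>C. window n x \<subseteq> C"
    using assms unfolding cylinder_sets_def by blast
  have "shift y \<in> window n (shift x)" if "y \<in> window (Suc n) x" for x y
    using that by (auto simp: window_def shift_def)
  with n have "\<forall>x\<in>shift -` C. window (Suc n) x \<subseteq> shift -` C" by blast
  then show ?thesis unfolding cylinder_sets_def by blast
qed

lemma continuous_shift: "continuous_on UNIV shift"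
  unfolding shift_def
  by (intro continuous_on_coordinatewise_then_product continuous_on_product_coordinates)

text \<open>A window is determined by its size and the finite list of its central entries. Open sets
  are therefore countable unions of windows.\<close>

lemma countable_windows: "countable (range (case_prod window))"
proof -
  let ?g = "\<lambda>(n, xs). {y :: int \<Rightarrow> nat. map y [- int n..int n] = xs}"
  have "case_prod window (n, x) = ?g (n, map x [- int n..int n])" for n x
    by (auto simp: window_def abs_le_iff)
  then have "range (case_prod window) \<subseteq> range ?g"
    by (metis (no_types, lifting) UNIV_I image_eqI image_subsetI surj_pair)
  then show ?thesis
    by (rule countable_subset) (intro countable_image countableI_type)
qed

lemma sigma_sets_cylinder: "sigma_sets UNIV cylinder_sets = sets borel"
proof
  show "sigma_sets UNIV cylinder_sets \<subseteq> sets borel"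
    unfolding sets_borel using cylinder_sets_open by (intro sigma_sets_mono) auto
next
  interpret sigma_algebra UNIV "sigma_sets UNIV cylinder_sets"
    by (rule sigma_algebra_sigma_sets) simp
  have "U \<in> sigma_sets UNIV cylinder_sets" if "open U" for U
  proof -
    let ?W = "{V \<in> range (case_prod window). V \<subseteq> U}"
    have "x \<in> \<Union>?W" if "x \<in> U" for x
      using open_contains_window[OF \<open>open U\<close> that] window_self[of x]
      by (metis (mono_tags, lifting) UNIV_I UnionI case_prod_conv image_eqI mem_Collect_eq)
    then have "U = \<Union>?W" by blast
    also have "\<dots> \<in> sigma_sets UNIV cylinder_sets"
    proof (rule countable_Union)
      show "countable ?W"
        by (rule countable_subset[OF _ countable_windows]) auto
      show "?W \<subseteq> sigma_sets UNIV cylinder_sets"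
        using window_cylinder by auto
    qed
    finally show ?thesis .
  qed
  then show "sets borel \<subseteq> sigma_sets UNIV cylinder_sets"
    unfolding sets_borel by (intro sigma_sets_mono) auto
qed

section \<open>Compactness\<close>

lemma compact_bounded_sequences:
  assumes "finite A" shows "compact {x :: int \<Rightarrow> nat. \<forall>i. x i \<in> A}"
proof -
  have "compactin (product_topology (\<lambda>i. euclidean) UNIV) (Pi\<^sub>E UNIV (\<lambda>i::int. A))"
    using assms by (simp add: compactin_PiE finite_imp_compact)
  then have "compact (Pi\<^sub>E UNIV (\<lambda>i::int. A))"
    by (simp add: euclidean_product_topology)
  moreover have "Pi\<^sub>E UNIV (\<lambda>i::int. A) = {x. \<forall>i. x i \<in> A}" by auto
  ultimately show ?thesis by simp
qed

text \<open>The finite intersection property applies, since finitely many terms of a decreasing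
  sequence intersect in the last of them. This serves both the construction of the measure and the
  nonemptiness of the subshift.\<close>

lemma compact_decseq_empty:
  assumes "compact K" "\<And>i. closed (F i)" "decseq F" "K \<inter> (\<Inter>i. F i) = {}"
  shows "\<exists>n::nat. K \<inter> F n = {}"
proof (rule ccontr)
  assume ne: "\<not> ?thesis"
  have "K \<inter> (\<Inter>i\<in>UNIV. F i) \<noteq> {}"
  proof (rule compact_imp_fip_image[where f = F, OF assms(1,2)])
    fix I :: "nat set" assume "finite I"
    have "F (Max (insert 0 I)) \<subseteq> F i" if "i \<in> I" for i
      by (rule decseqD[OF \<open>decseq F\<close>]) (use \<open>finite I\<close> that in simp)
    then have "K \<inter> F (Max (insert 0 I)) \<subseteq> K \<inter> (\<Inter>i\<in>I. F i)" by blast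
    then show "K \<inter> (\<Inter>i\<in>I. F i) \<noteq> {}" using ne by blast
  qed
  with assms(4) show False by simp
qed

section \<open>Unique ergodicity from convergence of frequencies\<close>

text \<open>A Birkhoff average of an indicator along the forward orbit. Length \<open>N = 0\<close>
  gives the value 0 by division by zero.\<close>

definition freq :: "nat \<Rightarrow> (int \<Rightarrow> nat) set \<Rightarrow> (int \<Rightarrow> nat) \<Rightarrow> real" where
  "freq N C x = (\<Sum>m<N. indicat_real C ((shift ^^ m) x)) / real N"

lemma freq_nonneg: "0 \<le> freq N C x"
  by (simp add: freq_def sum_nonneg)

lemma freq_le_1: "freq N C x \<le> 1"
proof -
  have "(\<Sum>m<N. indicat_real C ((shift ^^ m) x)) \<le> (\<Sum>m<N. 1)"
    by (rule sum_mono) (simp add: indicator_def)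
  then show ?thesis by (simp add: freq_def divide_le_eq)
qed

text \<open>An orbit segment of length \<open>2 * N\<close> splits into two of length
  \<open>N\<close>. Hence bounds on frequencies that hold uniformly on an invariant set survive
  doubling.\<close>

lemma freq_double:
  assumes "0 < N" shows "freq (2 * N) C x = (freq N C x + freq N C ((shift ^^ N) x)) / 2"
proof -
  let ?f = "\<lambda>m. indicat_real C ((shift ^^ m) x)"
  have "(\<Sum>m<2 * N. ?f m) = (\<Sum>m<N. ?f m) + (\<Sum>m<N. ?f (m + N))"
    using sum.atLeastLessThan_concat[of 0 N "2 * N" ?f] sum.shift_bounds_nat_ivl[of ?f 0 N N]
    by (simp add: lessThan_atLeast0 mult_2)
  also have "(\<Sum>m<N. ?f (m + N)) = (\<Sum>m<N. indicat_real C ((shift ^^ m) ((shift ^^ N) x)))"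
    by (simp only: funpow_add comp_apply)
  finally show ?thesis
    using assms by (simp add: freq_def add_divide_distrib)
qed

lemma freq_shift: "freq N (shift -` C) x = freq N C (shift x)"
  by (simp add: freq_def indicator_def funpow_swap1)

lemma freq_Un_disjoint: "C \<inter> D = {} \<Longrightarrow> freq N (C \<union> D) x = freq N C x + freq N D x"
  by (simp add: freq_def indicator_add[symmetric] sum.distrib add_divide_distrib)

lemma funpow_shift_in: "(\<And>x. x \<in> X \<Longrightarrow> shift x \<in> X) \<Longrightarrow> x \<in> X \<Longrightarrow> (shift ^^ m) x \<in> X"
  by (induction m) auto

lemma measurable_funpow_shift [measurable]: "shift ^^ m \<in> borel_measurable borel"
proof (induction m)
  case (Suc m)
  then show ?case
    using measurable_comp[OF Suc borel_measurable_continuous_onI[OF continuous_shift]]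
    by (simp add: comp_def)
qed (simp add: id_def)

lemma cylinder_sets_borel: "C \<in> cylinder_sets \<Longrightarrow> C \<in> sets borel"
  by (simp add: cylinder_sets_open borel_open)

section \<open>Uniqueness of the invariant measure\<close>

lemma measure_eqI_cylinder:
  fixes M M' :: "(int \<Rightarrow> nat) measure"
  assumes "sets M = sets borel" "sets M' = sets borel" "prob_space M"
    and "\<And>C. C \<in> cylinder_sets \<Longrightarrow> emeasure M C = emeasure M' C"
  shows "M = M'"
proof (rule measure_eqI_generator_eq[where \<Omega> = UNIV and E = cylinder_sets and A = "\<lambda>_. UNIV"])
  interpret prob_space M by fact
  show "emeasure M UNIV \<noteq> \<infinity>" by simp
qed (use assms sigma_sets_cylinder in \<open>auto simp: Int_stable_def cylinder_sets_Int\<close>)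

lemma invariant_measure_funpow:
  assumes "invariant_measure X M"
  shows "distr M borel (shift ^^ m) = M"
proof -
  have sM [measurable_cong]: "sets M = sets borel" and inv: "distr M M shift = M"
    using assms by (auto simp: invariant_measure_def)
  have [measurable]: "shift \<in> borel_measurable borel"
    by (rule borel_measurable_continuous_onI[OF continuous_shift])
  have inv': "distr M borel shift = M"
    using inv sM distr_cong[OF refl sM, where f = shift and g = shift] by simp
  show ?thesis
  proof (induction m)
    case 0
    have "distr M borel (shift ^^ 0) = distr M M (\<lambda>x. x)"
      by (rule distr_cong) (simp_all add: sM)
    then show ?case by (simp add: id_def)
  next
    case (Suc m)
    have "distr M borel (shift ^^ Suc m) = distr (distr M borel (shift ^^ m)) borel shift"
      by (subst distr_distr) simp_all
    also have "\<dots> = M" by (simp only: Suc inv')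
    finally show ?case .
  qed
qed

text \<open>Invariance gives every frequency function the integral \<open>prob C\<close>, and
  dominated convergence identifies this constant with the limit \<open>c\<close>. So all invariant
  measures agree on cylinder sets.\<close>

lemma invariant_measure_cylinder:
  assumes M: "invariant_measure X M" and X: "closed X"
    and N: "\<And>k. 0 < N k"
    and C: "C \<in> cylinder_sets" and lim: "\<And>x. x \<in> X \<Longrightarrow> (\<lambda>k. freq (N k) C x) \<longlonglongrightarrow> c"
  shows "emeasure M C = ennreal c"
proof -
  have sM [measurable_cong]: "sets M = sets borel" and "prob_space M" and MX: "emeasure M X = 1"
    using M by (auto simp: invariant_measure_def)
  interpret prob_space M by fact
  have [measurable]: "C \<in> sets borel" by (rule cylinder_sets_borel[OF C])
  \<comment> \<open>Convergence is known only on \<open>X\<close>, which has full measure.\<close>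
  have AE: "AE x in M. x \<in> X"
    using MX X by (intro AE_prob_1) (simp add: measure_def)
  have meas [measurable]: "freq n C \<in> borel_measurable M" for n
    unfolding freq_def by measurable
  have "integral\<^sup>L M (\<lambda>x. indicat_real C ((shift ^^ m) x)) = prob C" for m
  proof -
    have "integral\<^sup>L M (\<lambda>x. indicat_real C ((shift ^^ m) x))
        = integral\<^sup>L (distr M borel (shift ^^ m)) (indicat_real C)"
      by (rule integral_distr[symmetric]) measurable
    also have "\<dots> = prob C"
      using invariant_measure_funpow[OF M] sM sets_eq_imp_space_eq[OF sM]
      by (simp add: invariant_measure_funpow[OF M])
    finally show ?thesis .
  qed
  moreover have "integrable M (\<lambda>x. indicat_real C ((shift ^^ m) x))" for m
    by (rule integrable_const_bound[where B = 1]) (auto simp: indicator_def)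
  ultimately have int: "integral\<^sup>L M (freq (N k) C) = prob C" for k
    using N[of k] unfolding freq_def by (simp add: Bochner_Integration.integral_sum)
  have "(\<lambda>k. integral\<^sup>L M (freq (N k) C)) \<longlonglongrightarrow> integral\<^sup>L M (\<lambda>_. c)"
  proof (rule integral_dominated_convergence[where w = "\<lambda>_. 1"])
    show "AE x in M. (\<lambda>k. freq (N k) C x) \<longlonglongrightarrow> c" using AE lim by auto
  qed (auto simp: freq_nonneg freq_le_1)
  then have "prob C = c"
    using LIMSEQ_unique[OF tendsto_const] by (simp add: int prob_space)
  then show ?thesis by (simp add: emeasure_eq_measure)
qed

section \<open>Existence of the invariant measure\<close>

lemma exists_invariant_measure:
  assumes X: "compact X" "x0 \<in> X" and cl: "closed X" and sh: "\<And>x. x \<in> X \<Longrightarrow> shift x \<in> X"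
    and N: "\<And>k. 0 < N k"
    and lim: "\<And>C x. C \<in> cylinder_sets \<Longrightarrow> x \<in> X \<Longrightarrow> (\<lambda>k. freq (N k) C x) \<longlonglongrightarrow> c C"
  shows "\<exists>M. invariant_measure X M"
proof -
  interpret algebra UNIV cylinder_sets by (rule algebra_cylinder_sets)
  note lim0 = lim[OF _ X(2)]
  have c_nonneg: "0 \<le> c C" if "C \<in> cylinder_sets" for C
    by (rule LIMSEQ_le_const[OF lim0[OF that]]) (simp add: freq_nonneg)
  have c_eqI: "c C = d" if "C \<in> cylinder_sets" "\<And>k. freq (N k) C x0 = d" for C d
    using LIMSEQ_unique[OF lim0[OF that(1)]] that(2) by simp
  have c_empty: "c C = 0" if "C \<in> cylinder_sets" "X \<inter> C = {}" for C
    using that funpow_shift_in[OF sh X(2)]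
    by (intro c_eqI) (auto simp: freq_def indicator_def intro!: sum.neutral)
  have c_full: "c C = 1" if "C \<in> cylinder_sets" "X \<subseteq> C" for C
  proof -
    have "(shift ^^ m) x0 \<in> C" for m
      using that funpow_shift_in[OF sh X(2)] by blast
    with N show ?thesis
      using that(1) by (intro c_eqI) (auto simp: freq_def less_imp_neq[symmetric])
  qed
  have c_add: "c (C \<union> D) = c C + c D" if "C \<in> cylinder_sets" "D \<in> cylinder_sets" "C \<inter> D = {}" for C D
  proof (rule LIMSEQ_unique)
    show "(\<lambda>k. freq (N k) (C \<union> D) x0) \<longlonglongrightarrow> c (C \<union> D)"
      using that by (intro lim0) auto
    show "(\<lambda>k. freq (N k) (C \<union> D) x0) \<longlonglongrightarrow> c C + c D"
      unfolding freq_Un_disjoint[OF that(3)] using that by (intro tendsto_add lim0)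
  qed
  \<comment> \<open>The second limit runs along the orbit of \<open>shift x0\<close>; the limit
    \<open>c C\<close> is the same at every point of \<open>X\<close>.\<close>
  have c_shift: "c (shift -` C) = c C" if "C \<in> cylinder_sets" for C
  proof (rule LIMSEQ_unique)
    show "(\<lambda>k. freq (N k) (shift -` C) x0) \<longlonglongrightarrow> c (shift -` C)"
      using that by (intro lim0 cylinder_sets_shift)
    show "(\<lambda>k. freq (N k) (shift -` C) x0) \<longlonglongrightarrow> c C"
      unfolding freq_shift using that by (intro lim sh X)
  qed
  have "\<exists>\<mu>. (\<forall>C\<in>cylinder_sets. \<mu> C = ennreal (c C))
      \<and> measure_space UNIV (sigma_sets UNIV cylinder_sets) \<mu>"
  proof (rule caratheodory_empty_continuous)
    show "positive cylinder_sets (\<lambda>C. ennreal (c C))"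
      by (simp add: positive_def c_empty)
    show "additive cylinder_sets (\<lambda>C. ennreal (c C))"
      by (auto simp: additive_def c_add c_nonneg)
    \<comment> \<open>Continuity at the empty set: cylinder sets are closed, so a decreasing
      sequence of them with empty intersection misses the compact set \<open>X\<close> from some
      index on, and there the content is 0.\<close>
    fix A :: "nat \<Rightarrow> (int \<Rightarrow> nat) set"
    assume A: "range A \<subseteq> cylinder_sets" "decseq A" "(\<Inter>i. A i) = {}"
    then obtain n where n: "X \<inter> A n = {}"
      using compact_decseq_empty[OF X(1), of A] cylinder_sets_closed by auto
    have "eventually (\<lambda>i. ennreal (c (A i)) = 0) sequentially"
      using eventually_ge_at_top[of n]
    proof eventually_elim
      case (elim i)
      then have "X \<inter> A i = {}" using n decseqD[OF A(2)] by blast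
      then show ?case using A(1) by (simp add: c_empty range_subsetD)
    qed
    then show "(\<lambda>i. ennreal (c (A i))) \<longlonglongrightarrow> 0"
      by (rule tendsto_eventually)
  qed simp
  then obtain \<mu> where \<mu>: "\<And>C. C \<in> cylinder_sets \<Longrightarrow> \<mu> C = ennreal (c C)"
    and ms: "measure_space UNIV (sets borel) \<mu>"
    unfolding sigma_sets_cylinder by auto
  define M where "M = measure_of UNIV (sets borel) \<mu>"
  have sM [measurable_cong]: "sets M = sets borel"
    using sets.sigma_sets_eq[of "borel :: (int \<Rightarrow> nat) measure"]
    by (simp add: M_def)
  then have spM: "space M = UNIV" using sets_eq_imp_space_eq by fastforce
  have eM: "emeasure M A = \<mu> A" if "A \<in> sets borel" for A
    using ms that unfolding M_def measure_space_def
    by (intro emeasure_measure_of_sigma) auto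
  have MC: "emeasure M C = ennreal (c C)" if "C \<in> cylinder_sets" for C
    using that by (simp add: eM \<mu> cylinder_sets_borel)
  interpret M: prob_space M
    by standard (simp add: spM MC c_full)
  have "AE x in M. x \<in> X"
  proof -
    \<comment> \<open>\<open>X\<close> need not be a cylinder set, so it is approximated by cylinder
      neighbourhoods. Each has full measure, and as \<open>X\<close> is closed their intersection is
      \<open>X\<close>.\<close>
    define D where "D n = (\<Union>y\<in>X. window n y)" for n
    have D: "D n \<in> cylinder_sets" for n
    proof -
      have "\<forall>x\<in>D n. window n x \<subseteq> D n"
        unfolding D_def using window_trans by blast
      then show ?thesis unfolding cylinder_sets_def by blast
    qed
    have XD: "X \<subseteq> D n" for n unfolding D_def by auto
    have "AE x in M. x \<in> D n" for n
      using D[of n] XD[of n] by (intro M.AE_prob_1) (simp add: measure_def MC c_full)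
    then have "AE x in M. \<forall>n. x \<in> D n" by (simp add: AE_all_countable)
    moreover have "x \<in> X" if x: "\<forall>n. x \<in> D n" for x
    proof -
      have "window n x \<inter> X \<noteq> {}" for n
      proof -
        obtain y where "y \<in> X" "x \<in> window n y"
          using x unfolding D_def by blast
        then show ?thesis using window_sym[of x n y] by blast
      qed
      then show ?thesis
        using cl unfolding closed_window_iff by blast
    qed
    ultimately show ?thesis by auto
  qed
  then have "emeasure M X = 1"
    using sM cl by (intro M.emeasure_eq_1_AE) auto
  moreover have "distr M M shift = M"
  proof (rule measure_eqI_cylinder)
    have [measurable]: "shift \<in> measurable M M"
      using borel_measurable_continuous_onI[OF continuous_shift] by measurable
    show "prob_space (distr M M shift)" by (rule M.prob_space_distr) measurable
    fix C :: "(int \<Rightarrow> nat) set" assume C: "C \<in> cylinder_sets"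
    then show "emeasure (distr M M shift) C = emeasure M C"
      by (subst emeasure_distr)
        (simp_all add: sM spM cylinder_sets_borel MC cylinder_sets_shift c_shift)
  qed (simp_all add: sM)
  ultimately show ?thesis
    unfolding invariant_measure_def using sM M.prob_space_axioms by blast
qed

theorem uniquely_ergodicI:
  assumes X: "compact X" "X \<noteq> {}" and cl: "closed X" and sh: "\<And>x. x \<in> X \<Longrightarrow> shift x \<in> X"
    and N: "\<And>k. 0 < N k"
    and lim: "\<And>C. C \<in> cylinder_sets \<Longrightarrow> \<exists>c. \<forall>x\<in>X. (\<lambda>k. freq (N k) C x) \<longlonglongrightarrow> c"
  shows "uniquely_ergodic X"
proof -
  obtain c where c: "\<And>C x. C \<in> cylinder_sets \<Longrightarrow> x \<in> X \<Longrightarrow> (\<lambda>k. freq (N k) C x) \<longlonglongrightarrow> c C"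
    using lim by metis
  have "\<exists>M. invariant_measure X M"
    using X(2) exists_invariant_measure[OF X(1) _ cl sh N c] by blast
  moreover have "M = M'" if M: "invariant_measure X M" and M': "invariant_measure X M'" for M M'
  proof (rule measure_eqI_cylinder)
    show "emeasure M C = emeasure M' C" if "C \<in> cylinder_sets" for C
      using invariant_measure_cylinder[OF M cl N that c[OF that]]
        invariant_measure_cylinder[OF M' cl N that c[OF that]] by simp
  qed (use M M' in \<open>auto simp: invariant_measure_def\<close>)
  ultimately show ?thesis unfolding uniquely_ergodic_def by blast
qed

section \<open>The hierarchy of blocks\<close>

text \<open>Powers of the shift with integer exponent: an occurrence of a word may have to be moved
  in either direction.\<close>

definition shift_by :: "int \<Rightarrow> (int \<Rightarrow> nat) \<Rightarrow> (int \<Rightarrow> nat)" where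
  "shift_by m x = (\<lambda>i. x (i + m))"

definition block :: "(int \<Rightarrow> nat) \<Rightarrow> int \<Rightarrow> nat \<Rightarrow> nat list" where
  "block x p n = map (\<lambda>i. x (p + int i)) [0..<n]"

lemma words_eq_blocks: "words X n = {block x p n | x p. x \<in> X}"
  by (simp add: words_def block_def)

lemma length_block [simp]: "length (block x p n) = n"
  by (simp add: block_def)

lemma nth_block [simp]: "i < n \<Longrightarrow> block x p n ! i = x (p + int i)"
  by (simp add: block_def)

lemma block_append: "block x p (a + b) = block x p a @ block x (p + int a) b"
  by (rule nth_equalityI) (auto simp: nth_append algebra_simps)

lemma take_block: "a \<le> n \<Longrightarrow> take a (block x p n) = block x p a"
  by (rule nth_equalityI) auto

lemma drop_block: "drop a (block x p n) = block x (p + int a) (n - a)"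
  by (rule nth_equalityI) (auto simp: algebra_simps)

lemma block_shift_by: "block (shift_by m x) p n = block x (p + m) n"
  by (simp add: block_def shift_by_def algebra_simps)

lemma sublist_block:
  assumes "sublist w (block x p n)" obtains q where "block x q (length w) = w"
proof -
  obtain u v where uv: "block x p n = u @ w @ v"
    using assms unfolding sublist_def by blast
  have n: "n = length u + (length w + length v)"
    using arg_cong[OF uv, of length] by simp
  have "w = take (length w) (drop (length u) (block x p n))" by (simp add: uv)
  also have "\<dots> = block x (p + int (length u)) (length w)"
    by (simp add: drop_block take_block n)
  finally show ?thesis using that[of "p + int (length u)"] by simp
qed

lemma cylinder_sets_block: "{x. block x p n \<in> V} \<in> cylinder_sets"
proof -
  have "block y p n = block x p n" if "y \<in> window (nat \<bar>p\<bar> + n) x" for x y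
    unfolding block_def by (rule map_cong) (use that in \<open>auto simp: window_def\<close>)
  then have "\<forall>x\<in>{x. block x p n \<in> V}. window (nat \<bar>p\<bar> + n) x \<subseteq> {x. block x p n \<in> V}"
    by (metis (no_types, lifting) mem_Collect_eq subsetI)
  then show ?thesis unfolding cylinder_sets_def by blast
qed

lemma shift_eq_shift_by: "shift = shift_by 1"
  by (simp add: shift_def shift_by_def fun_eq_iff)

lemma shift_by_shift_by [simp]: "shift_by m (shift_by n x) = shift_by (m + n) x"
  by (simp add: shift_by_def algebra_simps)

lemma shift_by_0 [simp]: "shift_by 0 x = x"
  by (simp add: shift_by_def)

lemma funpow_shift: "(shift ^^ n) x = shift_by (int n) x"
  by (induction n) (simp_all add: shift_eq_shift_by)

lemma shift_by_invariant:
  assumes Y: "shift ` Y = Y" and y: "y \<in> Y" shows "shift_by m y \<in> Y"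
proof (cases "0 \<le> m")
  case True
  then have "shift_by m y = (shift ^^ nat m) y" by (simp add: funpow_shift)
  also have "\<dots> \<in> Y" using funpow_shift_in[of Y y] Y y by blast
  finally show ?thesis .
next
  case False
  \<comment> \<open>Surjectivity of \<open>shift\<close> on \<open>Y\<close> provides preimages step
    by step, and the \<open>n\<close>-th preimage can only be
    \<open>shift_by (- int n) y\<close>.\<close>
  have "\<exists>z\<in>Y. shift_by (int n) z = y" for n
  proof (induction n)
    case (Suc n)
    then obtain z where z: "z \<in> Y" "shift_by (int n) z = y" by blast
    then obtain z' where "z' \<in> Y" "z = shift z'" using Y by blast
    with z show ?case
      by (intro bexI[of _ z']) (simp_all add: shift_eq_shift_by algebra_simps)
  qed (use y in auto)
  then obtain z where "z \<in> Y" "shift_by (int (nat (- m))) z = y" by blast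
  with False show ?thesis by auto
qed

definition pick :: "nat list \<Rightarrow> nat list set \<Rightarrow> nat list" where
  "pick u V = (if \<exists>v\<in>V. sublist u v then SOME v. v \<in> V \<and> sublist u v else SOME v. v \<in> V)"

lemma pick_in: "V \<noteq> {} \<Longrightarrow> pick u V \<in> V"
  unfolding pick_def by (metis (mono_tags, lifting) ex_in_conv someI_ex)

lemma sublist_pick: "v \<in> V \<Longrightarrow> sublist u v \<Longrightarrow> sublist u (pick u V)"
  unfolding pick_def by (metis (mono_tags, lifting) someI_ex)

text \<open>\<open>S\<close> is the set of frozen levels, and \<open>e k\<close> is the word that a
  frozen level \<open>k\<close> is asked to plant in its fixed second half.\<close>

primrec blocks :: "nat set \<Rightarrow> (nat \<Rightarrow> nat list) \<Rightarrow> nat \<Rightarrow> nat list set" where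
  "blocks S e 0 = {[0], [1]}"
| "blocks S e (Suc k) =
    (if k \<in> S then (\<lambda>w. w @ pick (e k) (blocks S e k)) ` blocks S e k
     else (\<lambda>(v, w). v @ w) ` (blocks S e k \<times> blocks S e k))"

text \<open>The positions where two blocks of level \<open>k\<close> can differ. A frozen level adds
  none, since its second half is common to all blocks.\<close>

primrec holes :: "nat set \<Rightarrow> nat \<Rightarrow> nat set" where
  "holes S 0 = {0}"
| "holes S (Suc k) = (if k \<in> S then holes S k else holes S k \<union> (+) (2 ^ k) ` holes S k)"

lemma blocks_nonempty: "blocks S e k \<noteq> {}"
  by (induction k) auto

lemma finite_blocks: "finite (blocks S e k)"
  by (induction k) auto

lemma pick_blocks: "pick u (blocks S e k) \<in> blocks S e k"
  by (simp add: pick_in blocks_nonempty)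

lemma length_blocks: "w \<in> blocks S e k \<Longrightarrow> length w = 2 ^ k"
proof (induction k arbitrary: w)
  case (Suc k)
  then show ?case using pick_blocks[of "e k" S e k]
    by (auto split: if_splits)
qed auto

lemma set_blocks: "w \<in> blocks S e k \<Longrightarrow> set w \<subseteq> {0, 1}"
proof (induction k arbitrary: w)
  case (Suc k)
  show ?case
  proof (cases "k \<in> S")
    case True
    then obtain v where "v \<in> blocks S e k" "w = v @ pick (e k) (blocks S e k)"
      using Suc.prems by auto
    then show ?thesis
      using Suc.IH[OF pick_blocks] Suc.IH[of v] by simp
  next
    case False
    then obtain u v where "u \<in> blocks S e k" "v \<in> blocks S e k" "w = u @ v"
      using Suc.prems by auto
    then show ?thesis
      using Suc.IH[of u] Suc.IH[of v] by simp
  qed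
qed auto

lemma blocks_Suc_split:
  assumes "w \<in> blocks S e (Suc k)"
  shows "take (2 ^ k) w \<in> blocks S e k" "drop (2 ^ k) w \<in> blocks S e k"
  using assms length_blocks[of _ S e k] pick_blocks[of "e k" S e k]
  by (auto split: if_splits)

lemma card_lessThan_Suc_diff: "card ({..<Suc k} - S) = (if k \<in> S then 0 else 1) + card ({..<k} - S)"
  by (simp add: lessThan_Suc insert_Diff_if)

text \<open>Concatenation of words of equal length is injective, so a free level squares the count
  and a frozen level keeps it.\<close>

lemma card_blocks: "card (blocks S e k) = 2 ^ 2 ^ card ({..<k} - S)"
proof (induction k)
  case (Suc k)
  have "inj_on (\<lambda>(v, w). v @ w) (blocks S e k \<times> blocks S e k)"
    using length_blocks[of _ S e k] by (intro inj_onI) (auto simp: append_eq_append_conv)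
  moreover have "inj_on (\<lambda>w. w @ pick (e k) (blocks S e k)) (blocks S e k)"
    by (simp add: inj_on_def)
  ultimately show ?case
    using Suc.IH
    by (simp add: card_image card_cartesian_product card_lessThan_Suc_diff power_add[symmetric])
qed simp

lemma holes_less: "i \<in> holes S k \<Longrightarrow> i < 2 ^ k"
proof (induction k arbitrary: i)
  case (Suc k)
  then show ?case by (fastforce split: if_splits)
qed simp

lemma finite_holes: "finite (holes S k)"
  by (induction k) auto

lemma card_holes: "card (holes S k) = 2 ^ card ({..<k} - S)"
proof (induction k)
  case (Suc k)
  have "holes S k \<inter> (+) (2 ^ k) ` holes S k = {}"
    using holes_less[of _ S k] by fastforce
  then show ?case
    using Suc by (simp add: card_lessThan_Suc_diff card_Un_disjoint finite_holes card_image)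
qed simp

text \<open>The two halves are compared separately. At a frozen level the second halves coincide; at
  a free level their holes are the translated ones.\<close>

lemma blocks_agree:
  assumes "v \<in> blocks S e k" "w \<in> blocks S e k" "i < 2 ^ k" "i \<notin> holes S k"
  shows "v ! i = w ! i"
  using assms
proof (induction k arbitrary: v w i)
  case (Suc k)
  have len: "length (take (2 ^ k) u) = 2 ^ k" if "u \<in> blocks S e (Suc k)" for u
    using length_blocks[OF that] by simp
  have nth: "u ! i = (if i < 2 ^ k then take (2 ^ k) u ! i else drop (2 ^ k) u ! (i - 2 ^ k))"
    if "u \<in> blocks S e (Suc k)" for u
    using length_blocks[OF that] by simp
  show ?case
  proof (cases "i < 2 ^ k")
    case True
    then show ?thesis
      using Suc.IH[OF blocks_Suc_split(1)[OF Suc.prems(1)] blocks_Suc_split(1)[OF Suc.prems(2)] True]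
        Suc.prems(4) by (auto split: if_splits)
  next
    case False
    show ?thesis
    proof (cases "k \<in> S")
      case True
      then have "drop (2 ^ k) v = drop (2 ^ k) w"
        using Suc.prems(1,2) length_blocks[of _ S e k] by auto
      then show ?thesis using nth[OF Suc.prems(1)] nth[OF Suc.prems(2)] False by simp
    next
      case kS: False
      have "i - 2 ^ k \<notin> holes S k"
      proof
        assume "i - 2 ^ k \<in> holes S k"
        then have "2 ^ k + (i - 2 ^ k) \<in> (+) (2 ^ k) ` holes S k" by (rule imageI)
        then show False using Suc.prems(4) kS False by simp
      qed
      then have "drop (2 ^ k) v ! (i - 2 ^ k) = drop (2 ^ k) w ! (i - 2 ^ k)"
        using Suc.prems(3) False
        by (intro Suc.IH blocks_Suc_split Suc.prems) auto
      then show ?thesis using nth[OF Suc.prems(1)] nth[OF Suc.prems(2)] False by simp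
    qed
  qed
qed simp

text \<open>Appending the picked word gives a block of the next level at frozen and free levels
  alike.\<close>

lemma blocks_extend:
  assumes "w \<in> blocks S e j" "j \<le> k" shows "\<exists>v\<in>blocks S e k. sublist w v"
  using assms(2)
proof (induction k rule: dec_induct)
  case base
  then show ?case using assms(1) by blast
next
  case (step k)
  then obtain v where v: "v \<in> blocks S e k" "sublist w v" by blast
  have "v @ pick (e k) (blocks S e k) \<in> blocks S e (Suc k)"
    using v(1) pick_blocks[of "e k" S e k] by auto
  moreover have "sublist w (v @ pick (e k) (blocks S e k))"
    using v(2) by (meson sublist_append_rightI sublist_order.order.trans)
  ultimately show ?case by blast
qed

text \<open>Congruent numbers below \<open>N\<close> are equal, and an injective self-map of a
  finite set is onto. The rotation later aligns the phases of two sequences.\<close>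

lemma bij_betw_add_mod:
  assumes "0 < N" shows "bij_betw (\<lambda>m. nat ((int m + c) mod int N)) {..<N} {..<N}"
proof -
  have "inj_on (\<lambda>m. nat ((int m + c) mod int N)) {..<N}"
  proof (rule inj_onI)
    fix m m' assume m: "m \<in> {..<N}" "m' \<in> {..<N}"
      and "nat ((int m + c) mod int N) = nat ((int m' + c) mod int N)"
    then have "(int m + c) mod int N = (int m' + c) mod int N"
      using assms by (simp add: eq_nat_nat_iff)
    then have "int N dvd int m - int m'" by (simp add: mod_eq_dvd_iff)
    then show "m = m'"
      using m dvd_imp_le_int[of "int m - int m'" "int N"] by fastforce
  qed
  moreover from this have "(\<lambda>m. nat ((int m + c) mod int N)) ` {..<N} = {..<N}"
    using assms by (intro endo_inj_surj) (auto simp: nat_less_iff)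
  ultimately show ?thesis by (simp add: bij_betw_def)
qed

section \<open>The subshift of a block hierarchy\<close>

text \<open>Each list is requested at frozen levels beyond every bound, so a block is requested
  again after its own level. At the free levels, also unbounded, any two adjacent blocks form a
  block.\<close>

locale block_hierarchy =
  fixes S :: "nat set" and e :: "nat \<Rightarrow> nat list"
  assumes recurs: "\<And>w j. \<exists>k\<ge>j. k \<in> S \<and> e k = w"
    and infinite_Compl: "\<And>j. \<exists>k\<ge>j. k \<notin> S"
begin

abbreviation W :: "nat \<Rightarrow> nat list set" where
  "W \<equiv> blocks S e"

text \<open>The offsets at which \<open>x\<close> is cut into blocks of level \<open>k\<close>. No
  uniqueness modulo \<open>2 ^ k\<close> is claimed.\<close>

definition phases :: "nat \<Rightarrow> (int \<Rightarrow> nat) \<Rightarrow> int set" where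
  "phases k x = {r. \<forall>m. block x (r + m * 2 ^ k) (2 ^ k) \<in> W k}"

definition X :: "(int \<Rightarrow> nat) set" where
  "X = (\<Inter>k. {x. phases k x \<noteq> {}})"

lemma phases_block: "r \<in> phases k x \<Longrightarrow> block x (r + m * 2 ^ k) (2 ^ k) \<in> W k"
  by (simp add: phases_def)

lemma X_phases: "x \<in> X \<Longrightarrow> \<exists>r. r \<in> phases k x"
  by (auto simp: X_def)

lemma phases_mod: "r \<in> phases k x \<Longrightarrow> r mod 2 ^ k \<in> phases k x"
  unfolding phases_def mem_Collect_eq
proof
  fix m :: int
  assume *: "\<forall>m. block x (r + m * 2 ^ k) (2 ^ k) \<in> W k"
  have "r mod 2 ^ k + m * 2 ^ k = r + (m - r div 2 ^ k) * 2 ^ k"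
    by (simp add: left_diff_distrib minus_div_mult_eq_mod [symmetric])
  with * show "block x (r mod 2 ^ k + m * 2 ^ k) (2 ^ k) \<in> W k" by metis
qed

text \<open>The halves of a block are blocks one level down. Hence the sets defining
  \<open>X\<close> decrease, as the compactness argument requires.\<close>

lemma phases_Suc: "r \<in> phases (Suc k) x \<Longrightarrow> r \<in> phases k x"
  unfolding phases_def mem_Collect_eq
proof
  fix m :: int
  assume *: "\<forall>m. block x (r + m * 2 ^ Suc k) (2 ^ Suc k) \<in> W (Suc k)"
  define q where "q = m div 2"
  note B = blocks_Suc_split[OF *[rule_format, of q]]
  \<comment> \<open>Even \<open>m\<close> gives the first half of the \<open>q\<close>-th block of
    level \<open>Suc k\<close>, odd \<open>m\<close> the second half.\<close>
  show "block x (r + m * 2 ^ k) (2 ^ k) \<in> W k"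
  proof (cases "even m")
    case True
    then have "r + m * 2 ^ k = r + q * 2 ^ Suc k" by (auto simp: q_def)
    then show ?thesis using B(1) by (simp add: take_block mult.assoc)
  next
    case False
    then have "m = 2 * q + 1" by (simp add: q_def)
    then have "r + m * 2 ^ k = r + q * 2 ^ Suc k + int (2 ^ k)"
      by (simp add: algebra_simps)
    then show ?thesis using B(2) by (simp add: drop_block add.assoc)
  qed
qed

text \<open>Phases may be reduced modulo \<open>2 ^ k\<close>, which leaves a finite union of
  intersections of clopen conditions.\<close>

lemma closed_phases: "closed {x. phases k x \<noteq> {}}"
proof -
  have "{x. phases k x \<noteq> {}} =
      (\<Union>r\<in>{0..<2 ^ k}. \<Inter>m. {x. block x (r + m * 2 ^ k) (2 ^ k) \<in> W k})" (is "?L = ?R")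
  proof
    show "?L \<subseteq> ?R"
    proof
      fix x assume "x \<in> ?L"
      then obtain r where "r \<in> phases k x" by blast
      then have "r mod 2 ^ k \<in> phases k x" by (rule phases_mod)
      then show "x \<in> ?R"
        by (intro UN_I[of "r mod 2 ^ k"]) (auto simp: phases_def)
    qed
    show "?R \<subseteq> ?L" by (auto simp: phases_def)
  qed
  also have "closed \<dots>"
    by (intro closed_UN closed_INT ballI cylinder_sets_closed cylinder_sets_block) auto
  finally show ?thesis .
qed

lemma closed_X: "closed X"
  unfolding X_def by (intro closed_INT ballI closed_phases)

lemma X_alphabet: assumes "x \<in> X" shows "x i \<in> {0, 1}"
proof -
  obtain r where "r \<in> phases 0 x" using X_phases[OF assms] by blast
  from phases_block[OF this, of "i - r"] show ?thesis by (simp add: block_def)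
qed

lemma compact_X: "compact X"
proof -
  have "compact ({x. \<forall>i. x i \<in> {0, 1}} \<inter> X)"
    by (intro compact_Int_closed compact_bounded_sequences closed_X) simp
  moreover have "{x. \<forall>i. x i \<in> {0, 1}} \<inter> X = X" using X_alphabet by blast
  ultimately show ?thesis by simp
qed

text \<open>By compactness it suffices to satisfy each level alone, and the periodic repetition of
  one block of level \<open>k\<close> does so.\<close>

lemma X_nonempty: "X \<noteq> {}"
proof
  assume X: "X = {}"
  let ?K = "{x :: int \<Rightarrow> nat. \<forall>i. x i \<in> {0, 1}}"
  have "\<exists>k. ?K \<inter> {x. phases k x \<noteq> {}} = {}"
  proof (rule compact_decseq_empty)
    show "compact ?K" by (rule compact_bounded_sequences) simp
    show "decseq (\<lambda>k. {x. phases k x \<noteq> {}})"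
      using phases_Suc by (intro decseq_SucI) blast
    show "?K \<inter> (\<Inter>k. {x. phases k x \<noteq> {}}) = {}"
      using X unfolding X_def by blast
  qed (rule closed_phases)
  then obtain k where k: "?K \<inter> {x. phases k x \<noteq> {}} = {}" by blast
  obtain w where w: "w \<in> W k" using blocks_nonempty by blast
  define x :: "int \<Rightarrow> nat" where "x i = w ! nat (i mod 2 ^ k)" for i
  have len: "length w = 2 ^ k" using w by (rule length_blocks)
  have "x i \<in> {0, 1}" for i
    using subsetD[OF set_blocks[OF w] nth_mem[of "nat (i mod 2 ^ k)"]]
    by (simp add: x_def len nat_less_iff)
  moreover have "block x (0 + m * 2 ^ k) (2 ^ k) = w" for m
    by (rule nth_equalityI) (auto simp: x_def len)
  then have "0 \<in> phases k x" using w by (simp add: phases_def)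
  ultimately show False using k by blast
qed

lemma shift_by_X: assumes "x \<in> X" shows "shift_by m x \<in> X"
  unfolding X_def
proof (intro INT_I CollectI)
  fix k
  obtain r where "r \<in> phases k x" using X_phases[OF assms] by blast
  then have "r - m \<in> phases k (shift_by m x)"
    by (auto simp: phases_def block_shift_by algebra_simps)
  then show "phases k (shift_by m x) \<noteq> {}" by blast
qed

lemma shift_X: "shift ` X = X"
proof
  show "shift ` X \<subseteq> X" using shift_by_X by (auto simp: shift_eq_shift_by)
  show "X \<subseteq> shift ` X"
  proof
    fix x assume "x \<in> X"
    then show "x \<in> shift ` X"
      using shift_by_X[of x "-1"] by (intro image_eqI[of _ _ "shift_by (-1) x"])
        (simp_all add: shift_eq_shift_by)
  qed
qed

lemma is_subshift_X: "is_subshift {0, 1} X"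
  unfolding is_subshift_def using closed_X shift_X X_alphabet by blast

section \<open>Minimality\<close>

lemma block_occurs:
  assumes "w \<in> W j" "x \<in> X" obtains p where "block x p (2 ^ j) = w"
proof -
  \<comment> \<open>Level \<open>k\<close> is frozen, so each block of level \<open>Suc k\<close>
    ends with the picked word. That word contains \<open>w\<close>, because some block of level
    \<open>k\<close> does.\<close>
  obtain k where k: "j \<le> k" "k \<in> S" "e k = w" using recurs by blast
  obtain r where r: "r \<in> phases (Suc k) x" using X_phases[OF assms(2)] by blast
  have "sublist w (pick w (W k))"
    using blocks_extend[OF assms(1) k(1)] sublist_pick by blast
  then have "sublist w (v @ pick w (W k))" for v
    by (meson sublist_append_leftI sublist_order.order.trans)
  moreover have "block x (r + 0 * 2 ^ Suc k) (2 ^ Suc k) \<in> (\<lambda>v. v @ pick w (W k)) ` W k"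
    using phases_block[OF r, of 0] k by simp
  ultimately have "sublist w (block x (r + 0 * 2 ^ Suc k) (2 ^ Suc k))" by auto
  then show thesis
    using sublist_block[of w x "r + 0 * 2 ^ Suc k" "2 ^ Suc k"] length_blocks[OF assms(1)] that
    by metis
qed

text \<open>A stretch no longer than a block meets at most two consecutive blocks; \<open>a\<close>
  is its offset in the first one.\<close>

lemma block_cover:
  assumes "x \<in> X" "n \<le> 2 ^ k"
  obtains v w a where "v \<in> W k" "w \<in> W k" "a < 2 ^ k" "block x p n = take n (drop a (v @ w))"
proof -
  obtain r where r: "r \<in> phases k x" using X_phases[OF assms(1)] by blast
  define q where "q = (p - r) div 2 ^ k"
  define a where "a = nat ((p - r) mod 2 ^ k)"
  have a: "a < 2 ^ k" by (simp add: a_def nat_less_iff)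
  have p: "r + q * 2 ^ k + int a = p"
    using div_mult_mod_eq[of "p - r" "2 ^ k"] by (simp add: a_def q_def)
  have nxt: "r + q * 2 ^ k + int (2 ^ k) = r + (q + 1) * 2 ^ k" by (simp add: algebra_simps)
  have "take n (drop a (block x (r + q * 2 ^ k) (2 ^ k + 2 ^ k))) = block x p n"
    using a assms(2) by (simp add: drop_block take_block p)
  then show thesis
    using that[OF phases_block[OF r, of q] phases_block[OF r, of "q + 1"] a]
    by (simp add: block_append nxt[symmetric])
qed

text \<open>The two blocks covering the word are taken at a free level, where their concatenation is
  itself a block.\<close>

lemma word_in_block:
  assumes "x \<in> X" obtains k u where "u \<in> W k" "sublist (block x p n) u"
proof -
  obtain k where k: "n \<le> k" "k \<notin> S" using infinite_Compl by blast
  have "n \<le> 2 ^ k" using k(1) less_exp[of k] by linarith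
  from block_cover[OF assms this]
  obtain v w a where vw: "v \<in> W k" "w \<in> W k" and eq: "block x p n = take n (drop a (v @ w))"
    by metis
  have "v @ w \<in> W (Suc k)" using vw k(2) by auto
  moreover have "sublist (block x p n) (v @ w)"
    unfolding eq by (meson sublist_take sublist_drop sublist_order.order.trans)
  ultimately show thesis by (rule that)
qed

lemma minimal_X: "minimal_subshift X"
  unfolding minimal_subshift_def
proof (intro conjI allI impI, rule X_nonempty)
  fix Y assume "Y \<subseteq> X \<and> Y \<noteq> {} \<and> closed Y \<and> shift ` Y = Y"
  then have YX: "Y \<subseteq> X" and cl: "closed Y" and inv: "shift ` Y = Y" and "Y \<noteq> {}" by auto
  then obtain y where y: "y \<in> Y" by blast
  have "x \<in> Y" if x: "x \<in> X" for x
  proof -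
    have "window n x \<inter> Y \<noteq> {}" for n
    proof -
      obtain k u where u: "u \<in> W k" "sublist (block x (- int n) (2 * n + 1)) u"
        using word_in_block[OF x] by blast
      obtain p where "block y p (2 ^ k) = u" using block_occurs[OF u(1)] y YX by blast
      then obtain q where q: "block y q (2 * n + 1) = block x (- int n) (2 * n + 1)"
        using u(2) sublist_block[of "block x (- int n) (2 * n + 1)" y p "2 ^ k"] by auto
      \<comment> \<open>The word starts at \<open>q\<close> in \<open>y\<close> and at
        \<open>- int n\<close> in \<open>x\<close>, so moving \<open>y\<close> by
        \<open>q + int n\<close> places it in the window.\<close>
      have "y (i + (q + int n)) = x i" if "\<bar>i\<bar> \<le> int n" for i
      proof -
        have "nat (i + int n) < 2 * n + 1" using that by linarith
        moreover have "0 \<le> i + int n" using that by linarith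
        ultimately show ?thesis
          using arg_cong[OF q, of "\<lambda>l. l ! nat (i + int n)"] by (simp add: algebra_simps)
      qed
      then have "shift_by (q + int n) y \<in> window n x"
        by (simp add: window_def shift_by_def)
      then show ?thesis using shift_by_invariant[OF inv y] by blast
    qed
    then show ?thesis using cl unfolding closed_window_iff by blast
  qed
  with YX show "Y = X" by blast
qed

section \<open>Bounds on the number of words\<close>

lemma words_X_subset: "words X n \<subseteq> {xs. set xs \<subseteq> {0, 1} \<and> length xs = n}"
proof
  fix w assume "w \<in> words X n"
  then obtain x p where x: "x \<in> X" and w: "w = block x p n"
    unfolding words_eq_blocks by blast
  have "set w \<subseteq> range x" unfolding w block_def by auto
  also have "\<dots> \<subseteq> {0, 1}" using X_alphabet[OF x] by (rule image_subsetI)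
  finally show "w \<in> {xs. set xs \<subseteq> {0, 1} \<and> length xs = n}" by (simp add: w)
qed

lemma finite_words: "finite (words X n)"
  by (rule finite_subset[OF words_X_subset]) (simp add: finite_lists_length_eq)

lemma card_words_ge: "2 ^ 2 ^ card ({..<k} - S) \<le> card (words X (2 ^ k))"
proof -
  have "W k \<subseteq> words X (2 ^ k)"
  proof
    fix w assume "w \<in> W k"
    moreover obtain x where "x \<in> X" using X_nonempty by blast
    ultimately show "w \<in> words X (2 ^ k)"
      unfolding words_eq_blocks using block_occurs[of w k x] by blast
  qed
  from card_mono[OF finite_words this] show ?thesis by (simp add: card_blocks)
qed

text \<open>By \<open>block_cover\<close> a word is encoded by one of \<open>2 ^ k\<close> offsets
  and two blocks of level \<open>k\<close>.\<close>

lemma card_words_le: "card (words X (2 ^ k)) \<le> 2 ^ (k + 2 * 2 ^ card ({..<k} - S))"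
proof -
  let ?f = "\<lambda>(a, v, w). take (2 ^ k) (drop a (v @ w))"
  have "words X (2 ^ k) \<subseteq> ?f ` ({..<2 ^ k} \<times> W k \<times> W k)"
  proof
    fix u assume "u \<in> words X (2 ^ k)"
    then obtain x p where "x \<in> X" "u = block x p (2 ^ k)" unfolding words_eq_blocks by blast
    then obtain v w a where "v \<in> W k" "w \<in> W k" "a < 2 ^ k" "u = ?f (a, v, w)"
      using block_cover[of x "2 ^ k" k p] by auto
    then show "u \<in> ?f ` ({..<2 ^ k} \<times> W k \<times> W k)"
      by (intro image_eqI[of _ _ "(a, v, w)"]) simp_all
  qed
  then have "card (words X (2 ^ k)) \<le> card ({..<2 ^ k :: nat} \<times> W k \<times> W k)"
    by (intro surj_card_le) (auto simp: finite_blocks)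
  also have "\<dots> = 2 ^ (k + 2 * 2 ^ card ({..<k} - S))"
    by (simp add: card_cartesian_product card_blocks power_add mult_2)
  finally show ?thesis .
qed

lemma card_words_mono: assumes "m \<le> n" shows "card (words X m) \<le> card (words X n)"
proof (rule surj_card_le)
  show "words X m \<subseteq> take m ` words X n"
  proof
    fix w assume "w \<in> words X m"
    then obtain x p where "x \<in> X" "w = block x p m" unfolding words_eq_blocks by blast
    then show "w \<in> take m ` words X n"
      using assms by (intro image_eqI[of _ _ "block x p n"]) (auto simp: take_block words_eq_blocks)
  qed
qed (rule finite_words)

section \<open>Convergence of frequencies\<close>

lemma phases_nth:
  assumes r: "r \<in> phases k x" and v: "v \<in> W k" and i: "nat ((p - r) mod 2 ^ k) \<notin> holes S k"
  shows "x p = v ! nat ((p - r) mod 2 ^ k)"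
proof -
  let ?q = "(p - r) div 2 ^ k" and ?i = "nat ((p - r) mod 2 ^ k)"
  have less: "?i < 2 ^ k" by (simp add: nat_less_iff)
  have "x p = block x (r + ?q * 2 ^ k) (2 ^ k) ! ?i"
    using less div_mult_mod_eq[of "p - r" "2 ^ k"] by (simp add: algebra_simps)
  also have "\<dots> = v ! ?i"
    by (rule blocks_agree[OF phases_block[OF r] v less i])
  finally show ?thesis .
qed

text \<open>After alignment of phases, \<open>x\<close> agrees off the holes with the periodic
  repetition of one fixed block, whose frequency is \<open>g\<close>. A time is affected only if one
  of the \<open>2 * n + 1\<close> coordinates of its window falls on a hole.\<close>

lemma freq_deviation:
  assumes C: "\<And>x. x \<in> C \<Longrightarrow> window n x \<subseteq> C"
  obtains g where "\<And>x. x \<in> X \<Longrightarrow>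
    \<bar>freq (2 ^ k) C x - g\<bar> \<le> real (2 * n + 1) * (real (card (holes S k)) / 2 ^ k)"
proof -
  obtain v where v: "v \<in> W k" using blocks_nonempty by blast
  define y :: "int \<Rightarrow> nat" where "y i = v ! nat (i mod 2 ^ k)" for i
  define N :: nat where "N = 2 ^ k"
  have N: "0 < N" "(2 :: int) ^ k = int N" "(2 :: real) ^ k = real N" by (simp_all add: N_def)
  \<comment> \<open>\<open>Z i\<close> holds the times whose window has a hole at relative position
    \<open>i\<close>, and \<open>bad\<close> those with a hole anywhere in the window.\<close>
  define Z where "Z i = {m \<in> {..<N}. nat ((int m + i) mod int N) \<in> holes S k}" for i :: int
  define bad where "bad = (\<Union>i\<in>{- int n..int n}. Z i)"
  have fin: "finite (Z i)" for i by (simp add: Z_def)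
  have "card (Z i) \<le> card (holes S k)" for i
    using bij_betw_add_mod[OF N(1), of i]
    by (intro card_inj_on_le[of "\<lambda>m. nat ((int m + i) mod int N)"])
      (auto simp: Z_def finite_holes bij_betw_def elim: inj_on_subset)
  then have "card bad \<le> (\<Sum>i\<in>{- int n..int n}. card (holes S k))"
    unfolding bad_def by (intro order_trans[OF card_UN_le] sum_mono) simp_all
  then have card_bad: "card bad \<le> (2 * n + 1) * card (holes S k)" by (simp add: nat_add_distrib nat_mult_distrib)
  have Cw: "a \<in> C \<longleftrightarrow> b \<in> C" if "a \<in> window n b" for a b
    using C[of a] C[of b] that window_sym[of a n b] by blast
  have "\<bar>freq N C x - freq N C y\<bar> \<le> real (2 * n + 1) * (real (card (holes S k)) / real N)"
    if x: "x \<in> X" for x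
  proof -
    obtain r where r: "r \<in> phases k x" using X_phases[OF x] by blast
    \<comment> \<open>Time \<open>m\<close> of \<open>x\<close> corresponds to time
      \<open>f m\<close> of \<open>y\<close>, since \<open>r\<close> is a phase of \<open>x\<close>
      and 0 is one of \<open>y\<close>. As \<open>f\<close> permutes a full period, sums over it can
      be reindexed.\<close>
    define f where "f m = nat ((int m + (- r)) mod int N)" for m
    have bij: "bij_betw f {..<N} {..<N}"
      unfolding f_def by (rule bij_betw_add_mod[OF N(1)])
    let ?a = "\<lambda>m. indicat_real C ((shift ^^ m) x)" and ?b = "\<lambda>m. indicat_real C ((shift ^^ m) y)"
    have close: "\<bar>?a m - ?b (f m)\<bar> \<le> indicat_real bad (f m)" if m: "m < N" for m
    proof (cases "f m \<in> bad")
      case False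
      have fN: "f m \<in> {..<N}" using bij m by (auto simp: bij_betw_def)
      have int_f: "int (f m) = (int m - r) mod int N" using N(1) by (simp add: f_def)
      have "x (i + int m) = y (i + int (f m))" if i: "\<bar>i\<bar> \<le> int n" for i
      proof -
        have eq: "(int (f m) + i) mod int N = (i + int m - r) mod int N"
          unfolding int_f by (simp add: mod_simps algebra_simps)
        have "i \<in> {- int n..int n}" using i by (simp add: abs_le_iff)
        then have "f m \<notin> Z i" using False unfolding bad_def by blast
        then have "nat ((i + int m - r) mod int N) \<notin> holes S k"
          using fN unfolding Z_def eq[symmetric] by simp
        then have "x (i + int m) = v ! nat ((i + int m - r) mod int N)"
          using phases_nth[OF r v, of "i + int m"] by (simp add: N)
        also have "\<dots> = y (i + int (f m))"
          unfolding y_def N eq[symmetric] by (simp add: add.commute)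
        finally show ?thesis .
      qed
      then have "(shift ^^ m) x \<in> window n ((shift ^^ f m) y)"
        by (simp add: window_def funpow_shift shift_by_def)
      from Cw[OF this] show ?thesis by (simp add: indicator_def)
    qed (auto simp: indicator_def)
    have "(\<Sum>m<N. ?b m) = (\<Sum>m<N. ?b (f m))"
      by (rule sum.reindex_bij_betw[OF bij, symmetric])
    then have "\<bar>(\<Sum>m<N. ?a m) - (\<Sum>m<N. ?b m)\<bar> \<le> (\<Sum>m<N. \<bar>?a m - ?b (f m)\<bar>)"
      by (simp add: sum_subtractf[symmetric])
    also have "\<dots> \<le> (\<Sum>m<N. indicat_real bad (f m))"
      by (intro sum_mono close) simp
    also have "\<dots> = (\<Sum>m<N. indicat_real bad m)"
      by (rule sum.reindex_bij_betw[OF bij])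
    also have "\<dots> = real (card bad)"
    proof -
      have "bad \<subseteq> {..<N}" by (auto simp: bad_def Z_def)
      then show ?thesis
        by (simp add: indicator_def sum.If_cases Int_absorb1)
    qed
    also have "\<dots> \<le> real (2 * n + 1) * real (card (holes S k))"
      using card_bad by (metis of_nat_le_iff of_nat_mult)
    finally show ?thesis
      using N(1) by (simp add: freq_def diff_divide_distrib[symmetric] divide_right_mono)
  qed
  then show thesis by (intro that[of "freq N C y"]) (simp add: N_def)
qed

text \<open>Each frozen level below \<open>k\<close> halves the density, and \<open>S\<close> is
  infinite by \<open>recurs\<close>.\<close>

lemma hole_density: "(\<lambda>k. real (card (holes S k)) / 2 ^ k) \<longlonglongrightarrow> 0"
proof -
  have eq: "real (card (holes S k)) / 2 ^ k = (1 / 2) ^ card ({..<k} \<inter> S)" for k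
  proof -
    have "card ({..<k} - S) + card ({..<k} \<inter> S) = k"
      using card_Diff_subset_Int[of "{..<k}" S] card_mono[of "{..<k}" "{..<k} \<inter> S"] by simp
    then have "(2 :: real) ^ k = 2 ^ card ({..<k} - S) * 2 ^ card ({..<k} \<inter> S)"
      by (metis power_add)
    then show ?thesis by (simp add: card_holes power_divide)
  qed
  have "infinite S"
    unfolding infinite_nat_iff_unbounded_le using recurs by blast
  have "filterlim (\<lambda>k. card ({..<k} \<inter> S)) at_top sequentially"
    unfolding filterlim_at_top
  proof
    fix z
    obtain T where T: "finite T" "card T = z" "T \<subseteq> S"
      using infinite_arbitrarily_large[OF \<open>infinite S\<close>] by blast
    then obtain j where j: "T \<subseteq> {..<j}" using finite_nat_iff_bounded by blast
    show "\<forall>\<^sub>F k in sequentially. z \<le> card ({..<k} \<inter> S)"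
      using eventually_ge_at_top[of j]
    proof eventually_elim
      case (elim k)
      then have "T \<subseteq> {..<k} \<inter> S" using j T(3) by auto
      then show ?case using card_mono[of "{..<k} \<inter> S" T] T(2) by simp
    qed
  qed
  then show ?thesis
    unfolding eq by (rule filterlim_compose[OF LIMSEQ_power_zero, rotated]) simp
qed

text \<open>By doubling, the bound at level \<open>j\<close> passes to all lengths
  \<open>2 ^ k\<close> with \<open>j \<le> k\<close>, with the same constant \<open>g j\<close>.
  This makes \<open>g\<close> a Cauchy sequence, and its limit does not depend on the point of
  \<open>X\<close>.\<close>

lemma freq_converges:
  assumes "C \<in> cylinder_sets" shows "\<exists>c. \<forall>x\<in>X. (\<lambda>k. freq (2 ^ k) C x) \<longlonglongrightarrow> c"
proof -
  obtain n where n: "\<And>x. x \<in> C \<Longrightarrow> window n x \<subseteq> C"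
    using assms unfolding cylinder_sets_def by blast
  define b where "b k = real (2 * n + 1) * (real (card (holes S k)) / 2 ^ k)" for k
  have "\<exists>g. \<forall>x\<in>X. \<bar>freq (2 ^ k) C x - g\<bar> \<le> b k" for k
    using freq_deviation[OF n, of k] unfolding b_def by metis
  then obtain g where g: "\<And>k x. x \<in> X \<Longrightarrow> \<bar>freq (2 ^ k) C x - g k\<bar> \<le> b k" by metis
  have dev: "\<forall>x\<in>X. \<bar>freq (2 ^ k) C x - g j\<bar> \<le> b j" if "j \<le> k" for j k
    using that
  proof (induction k rule: dec_induct)
    case (step k)
    show ?case
    proof
      fix x assume x: "x \<in> X"
      let ?x' = "(shift ^^ (2 ^ k)) x"
      have "?x' \<in> X" using x by (simp add: funpow_shift shift_by_X)
      with x step.IH have "\<bar>freq (2 ^ k) C x - g j\<bar> \<le> b j" "\<bar>freq (2 ^ k) C ?x' - g j\<bar> \<le> b j"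
        by blast+
      then show "\<bar>freq (2 ^ Suc k) C x - g j\<bar> \<le> b j"
        using freq_double[of "2 ^ k" C x] by (simp add: abs_le_iff field_simps)
    qed
  qed (use g in blast)
  have b: "b \<longlonglongrightarrow> 0"
    unfolding b_def using tendsto_mult_left[OF hole_density, of "real (2 * n + 1)"] by simp
  have "Cauchy g"
  proof (rule metric_CauchyI)
    fix \<epsilon> :: real assume "0 < \<epsilon>"
    then obtain M where M: "\<And>k. k \<ge> M \<Longrightarrow> b k < \<epsilon> / 4"
      using order_tendstoD(2)[OF b, of "\<epsilon> / 4"] unfolding eventually_sequentially by auto
    obtain x where x: "x \<in> X" using X_nonempty by blast
    show "\<exists>M. \<forall>m\<ge>M. \<forall>n\<ge>M. dist (g m) (g n) < \<epsilon>"
    proof (intro exI allI impI)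
      fix k l assume "M \<le> k" "M \<le> l"
      \<comment> \<open>The path from \<open>g k\<close> to \<open>g l\<close> leads through the two
        frequencies and \<open>g M\<close>; each of its four steps is shorter than
        \<open>\<epsilon> / 4\<close>.\<close>
      with dev[of M k] dev[of M l] g[OF x, of k] g[OF x, of l] M[of k] M[of l] M[of M] x
      have "\<bar>freq (2 ^ k) C x - g M\<bar> < \<epsilon> / 4" "\<bar>freq (2 ^ l) C x - g M\<bar> < \<epsilon> / 4"
        "\<bar>freq (2 ^ k) C x - g k\<bar> < \<epsilon> / 4" "\<bar>freq (2 ^ l) C x - g l\<bar> < \<epsilon> / 4"
        by (meson order.refl order.strict_trans1)+
      then show "dist (g k) (g l) < \<epsilon>" unfolding dist_real_def by linarith
    qed
  qed
  then obtain c where c: "g \<longlonglongrightarrow> c" using Cauchy_convergent_iff convergent_def by blast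
  have "(\<lambda>k. freq (2 ^ k) C x) \<longlonglongrightarrow> c" if x: "x \<in> X" for x
  proof -
    have "(\<lambda>k. freq (2 ^ k) C x - g k) \<longlonglongrightarrow> 0"
      by (rule Lim_null_comparison[OF _ b]) (simp add: g[OF x])
    from tendsto_add[OF this c] show ?thesis by simp
  qed
  then show ?thesis by blast
qed

lemma strictly_ergodic_X: "strictly_ergodic X"
  unfolding strictly_ergodic_def
proof (intro conjI minimal_X uniquely_ergodicI[where N = "\<lambda>k. 2 ^ k"])
  show "shift x \<in> X" if "x \<in> X" for x using that shift_X by blast
qed (use compact_X closed_X X_nonempty freq_converges in auto)

end

section \<open>Entropy dimension\<close>

text \<open>The bounds force genuine limits of the quotients for every positive exponent other than
  \<alpha>, because logarithms are negligible against powers. The upper and the lower dimension are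
  thus obtained together.\<close>

lemma entropy_dimI:
  fixes X :: "(int \<Rightarrow> nat) set" and \<alpha> c C :: real
  assumes "0 < \<alpha>" "0 < c"
    and lower: "\<And>n. 0 < n \<Longrightarrow> c * real n powr \<alpha> \<le> ln (real (card (words X n)))"
    and upper: "\<And>n. 0 < n \<Longrightarrow> ln (real (card (words X n))) \<le> C * real n powr \<alpha> + ln (real n) + 1"
  shows "entropy_dim X (ereal \<alpha>)"
proof -
  define f where "f \<beta> n = ln (real (card (words X n))) / real n powr \<beta>" for \<beta> n
  have "(\<lambda>n. ereal (f \<beta> n)) \<longlonglongrightarrow> \<infinity>" if \<beta>: "0 < \<beta>" "\<beta> < \<alpha>" for \<beta>
  proof -
    have "filterlim (\<lambda>n. c * real n powr \<alpha> / real n powr \<beta>) at_top sequentially"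
      using \<beta> assms by real_asymp
    moreover have "\<forall>\<^sub>F n in sequentially. c * real n powr \<alpha> / real n powr \<beta> \<le> f \<beta> n"
      using eventually_gt_at_top[of 0]
      by eventually_elim (simp add: f_def lower divide_right_mono)
    ultimately have "filterlim (f \<beta>) at_top sequentially"
      by (rule filterlim_at_top_mono)
    then show ?thesis by (simp add: tendsto_PInfty_eq_at_top)
  qed
  moreover have "(\<lambda>n. ereal (f \<beta> n)) \<longlonglongrightarrow> 0" if \<beta>: "\<alpha> < \<beta>" for \<beta>
  proof -
    have lim: "(\<lambda>n. (C * real n powr \<alpha> + ln (real n) + 1) / real n powr \<beta>) \<longlonglongrightarrow> 0"
      using \<beta> assms(1) by real_asymp
    have upp: "\<forall>\<^sub>F n in sequentially. f \<beta> n \<le> (C * real n powr \<alpha> + ln (real n) + 1) / real n powr \<beta>"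
      using eventually_gt_at_top[of 0]
      by eventually_elim (simp add: f_def upper divide_right_mono)
    have low: "\<forall>\<^sub>F n in sequentially. 0 \<le> f \<beta> n"
      using eventually_gt_at_top[of 0]
    proof eventually_elim
      case (elim n)
      have "0 \<le> c * real n powr \<alpha>" using assms(2) by simp
      also have "\<dots> \<le> ln (real (card (words X n)))" by (rule lower[OF elim])
      finally show ?case by (simp add: f_def)
    qed
    have "f \<beta> \<longlonglongrightarrow> 0"
      by (rule tendsto_sandwich[OF low upp tendsto_const lim])
    then show ?thesis unfolding zero_ereal_def by (rule tendsto_ereal)
  qed
  ultimately show ?thesis
    using \<open>0 < \<alpha>\<close>
    unfolding entropy_dim_def upper_entropy_dim_def lower_entropy_dim_def f_def
    by (auto intro!: lim_imp_Limsup lim_imp_Liminf)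
qed

section \<open>Choice of the free and frozen levels\<close>

lemma ex_recurrent_enumeration:
  assumes "infinite (S :: nat set)"
  obtains e :: "nat \<Rightarrow> 'a :: countable" where "\<And>w j. \<exists>k\<ge>j. k \<in> S \<and> e k = w"
proof
  let ?e = "\<lambda>k. from_nat (fst (prod_decode (inv (enumerate S) k))) :: 'a"
  fix w :: 'a and j
  \<comment> \<open>The index of a level in \<open>S\<close> is decoded as a pair whose first
    component gives \<open>w\<close>. Taking \<open>j\<close> as the second component pushes the
    index, and with it the element of \<open>S\<close>, to at least \<open>j\<close>.\<close>
  define n where "n = prod_encode (to_nat w, j)"
  have "inj (enumerate S)"
    using strict_mono_enumerate[OF assms] by (rule strict_mono_imp_inj_on)
  then have "?e (enumerate S n) = w" by (simp add: n_def)
  moreover have "j \<le> enumerate S n"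
    using le_prod_encode_2[of j "to_nat w"] le_enumerate[OF assms, of n] by (simp add: n_def)
  ultimately show "\<exists>k\<ge>j. k \<in> S \<and> ?e k = w"
    using enumerate_in_set[OF assms] by blast
qed

text \<open>The jumps of the floor of \<alpha> k, as in a Sturmian word of slope \<alpha>. For
  \<alpha> between 0 and 1 each jump is by one, so counting the jumps recovers the floor.\<close>

definition free_levels :: "real \<Rightarrow> nat set" where
  "free_levels \<alpha> = {k. \<lfloor>\<alpha> * real (Suc k)\<rfloor> \<noteq> \<lfloor>\<alpha> * real k\<rfloor>}"

lemma floor_Suc:
  assumes "0 < \<alpha>" "\<alpha> < 1"
  shows "\<lfloor>\<alpha> * real (Suc k)\<rfloor> = \<lfloor>\<alpha> * real k\<rfloor> + (if k \<in> free_levels \<alpha> then 1 else 0)"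
proof -
  have "\<alpha> * real (Suc k) = \<alpha> * real k + \<alpha>" by (simp add: algebra_simps)
  then have "\<lfloor>\<alpha> * real k\<rfloor> \<le> \<lfloor>\<alpha> * real (Suc k)\<rfloor>" "\<lfloor>\<alpha> * real (Suc k)\<rfloor> \<le> \<lfloor>\<alpha> * real k\<rfloor> + 1"
    using assms by linarith+
  then show ?thesis by (auto simp: free_levels_def)
qed

lemma card_free_levels:
  assumes "0 < \<alpha>" "\<alpha> < 1"
  shows "int (card ({..<k} \<inter> free_levels \<alpha>)) = \<lfloor>\<alpha> * real k\<rfloor>"
proof (induction k)
  case (Suc k)
  have "card ({..<Suc k} \<inter> free_levels \<alpha>)
      = card ({..<k} \<inter> free_levels \<alpha>) + (if k \<in> free_levels \<alpha> then 1 else 0)"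
    by (simp add: lessThan_Suc Int_insert_left)
  then show ?case unfolding floor_Suc[OF assms] by (simp flip: Suc)
qed simp

text \<open>If all levels from \<open>j\<close> on were of one kind, the floor would grow with slope
  1 or 0. The next lemma contrasts this with the slope \<alpha> strictly between.\<close>

lemma floor_add_free:
  assumes "0 < \<alpha>" "\<alpha> < 1" "\<And>k. j \<le> k \<Longrightarrow> (k \<in> free_levels \<alpha>) = b"
  shows "\<lfloor>\<alpha> * real (j + n)\<rfloor> = \<lfloor>\<alpha> * real j\<rfloor> + (if b then int n else 0)"
proof (induction n)
  case (Suc n)
  then show ?case using floor_Suc[OF assms(1,2), of "j + n"] assms(3)[of "j + n"] by auto
qed simp

lemma free_levels_infinite:
  assumes \<alpha>: "0 < \<alpha>" "\<alpha> < 1"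
  shows "\<exists>k\<ge>j. k \<in> free_levels \<alpha>" "\<exists>k\<ge>j. k \<notin> free_levels \<alpha>"
proof -
  obtain n where n: "1 < real n * \<alpha>" using reals_Archimedean3[OF \<alpha>(1)] by blast
  show "\<exists>k\<ge>j. k \<in> free_levels \<alpha>"
  proof (rule ccontr)
    assume "\<not> ?thesis"
    then have "\<lfloor>\<alpha> * real (j + n)\<rfloor> = \<lfloor>\<alpha> * real j\<rfloor>"
      using floor_add_free[OF \<alpha>, of j False n] by simp
    moreover have "\<alpha> * real (j + n) = \<alpha> * real j + real n * \<alpha>" by (simp add: algebra_simps)
    ultimately show False using n by linarith
  qed
  \<comment> \<open>Over \<open>n\<close> levels the growth of \<alpha> k falls short of
    \<open>n\<close> by more than 1, so these levels cannot all be free.\<close>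
  obtain n where n: "1 < real n * (1 - \<alpha>)" using reals_Archimedean3[of "1 - \<alpha>"] \<alpha>(2) by auto
  show "\<exists>k\<ge>j. k \<notin> free_levels \<alpha>"
  proof (rule ccontr)
    assume "\<not> ?thesis"
    then have "\<lfloor>\<alpha> * real (j + n)\<rfloor> = \<lfloor>\<alpha> * real j\<rfloor> + int n"
      using floor_add_free[OF \<alpha>, of j True n] by simp
    moreover have "\<alpha> * real (j + n) = \<alpha> * real j + real n - real n * (1 - \<alpha>)"
      by (simp add: algebra_simps)
    ultimately show False using n by linarith
  qed
qed

theorem theorem3p2:
  fixes \<alpha> :: real
  assumes "0 < \<alpha>" and "\<alpha> < 1"
  shows "\<exists>(A::nat set) X. is_subshift A X \<and> strictly_ergodic X \<and> entropy_dim X (ereal \<alpha>)"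
proof -
  define S where "S = - free_levels \<alpha>"
  have "infinite S"
    unfolding infinite_nat_iff_unbounded_le S_def using free_levels_infinite(2)[OF assms] by simp
  then obtain e :: "nat \<Rightarrow> nat list" where e: "\<And>w j. \<exists>k\<ge>j. k \<in> S \<and> e k = w"
    by (rule ex_recurrent_enumeration[where 'a = "nat list"]) (rule that)
  interpret block_hierarchy S e
  proof
    show "\<exists>k\<ge>j. k \<notin> S" for j
      using free_levels_infinite(1)[OF assms] by (simp add: S_def)
  qed (rule e)
  define h where "h k = card ({..<k} - S)" for k
  have h: "int (h k) = \<lfloor>\<alpha> * real k\<rfloor>" for k
    using card_free_levels[OF assms, of k] by (simp add: h_def S_def Diff_eq)
  have "entropy_dim X (ereal \<alpha>)"
  proof (rule entropy_dimI)
    fix n :: nat assume n: "0 < n"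
    obtain k where k: "2 ^ k \<le> n" "n < 2 ^ Suc k"
      using ex_power_ivl1[of 2 n] n by auto
    have powr_k: "(2 :: real) powr (\<alpha> * real i) = (2 ^ i) powr \<alpha>" for i
      by (simp add: powr_realpow[symmetric] powr_powr mult.commute)
    have pos: "0 < card (words X (2 ^ k))"
      using card_words_ge[of k] by (metis less_le_trans zero_less_numeral zero_less_power)
    \<comment> \<open>Passing from \<open>n\<close> to \<open>2 ^ Suc k\<close> costs the factor
      \<open>2 powr \<alpha>\<close>, and the floor in \<open>h k\<close> at most a factor 2.
      Together this is at most 4, hence the constant \<open>ln 2 / 4\<close>.\<close>
    have "ln 2 / 4 * real n powr \<alpha> \<le> ln 2 * (real n powr \<alpha> * 2 powr (- \<alpha> - 1))"
    proof -
      have "(1 / 4 :: real) = 2 powr (- 2)" by (simp add: powr_minus)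
      also have "\<dots> \<le> 2 powr (- \<alpha> - 1)" using assms by (intro powr_mono) auto
      finally have "1 / 4 * real n powr \<alpha> \<le> 2 powr (- \<alpha> - 1) * real n powr \<alpha>"
        by (rule mult_right_mono) simp
      then show ?thesis by (simp add: mult.commute)
    qed
    also have "\<dots> \<le> ln 2 * (2 powr (\<alpha> * real (Suc k)) * 2 powr (- \<alpha> - 1))"
    proof -
      have "real n \<le> 2 ^ Suc k" using k(2) by (metis less_imp_le of_nat_le_iff of_nat_numeral of_nat_power)
      then have "real n powr \<alpha> \<le> 2 powr (\<alpha> * real (Suc k))"
        unfolding powr_k using assms by (intro powr_mono2) auto
      then show ?thesis by (intro mult_left_mono mult_right_mono) auto
    qed
    also have "\<dots> = ln 2 * 2 powr (\<alpha> * real k - 1)"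
      by (simp add: powr_add[symmetric] algebra_simps)
    also have "\<dots> \<le> ln 2 * 2 ^ h k"
    proof -
      have "\<alpha> * real k - 1 \<le> real (h k)" using h[of k] by linarith
      then have "2 powr (\<alpha> * real k - 1) \<le> 2 powr real (h k)" by (intro powr_mono) auto
      then show ?thesis by (simp add: powr_realpow)
    qed
    also have "\<dots> = ln (real (2 ^ 2 ^ h k))" by (simp add: ln_realpow)
    also have "\<dots> \<le> ln (real (card (words X n)))"
    proof -
      have "2 ^ 2 ^ h k \<le> card (words X n)"
        using card_words_ge[of k] card_words_mono[OF k(1)] by (simp add: h_def)
      then have "real (2 ^ 2 ^ h k) \<le> real (card (words X n))" by (simp only: of_nat_le_iff)
      then show ?thesis by (intro ln_mono) simp_all
    qed
    finally show "ln 2 / 4 * real n powr \<alpha> \<le> ln (real (card (words X n)))" .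
    have "0 < card (words X n)"
      using pos card_words_mono[OF k(1)] by linarith
    moreover have "card (words X n) \<le> 2 ^ (Suc k + 2 * 2 ^ h (Suc k))"
      using card_words_le[of "Suc k"] card_words_mono[of n "2 ^ Suc k"] k(2) by (simp add: h_def)
    then have "real (card (words X n)) \<le> real (2 ^ (Suc k + 2 * 2 ^ h (Suc k)))"
      by (simp only: of_nat_le_iff)
    ultimately have "ln (real (card (words X n))) \<le> ln (real (2 ^ (Suc k + 2 * 2 ^ h (Suc k))))"
      by (intro ln_mono) simp_all
    also have "\<dots> = ln (2 ^ k) + (1 + 2 * 2 ^ h (Suc k)) * ln 2"
      by (simp add: ln_realpow ring_distribs del: power_Suc)
    \<comment> \<open>Here \<open>2 ^ k \<le> n\<close> bounds the logarithm, and
      \<open>2 powr \<alpha> \<le> 2\<close> turns the coefficient 2 into 4.\<close>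
    also have "\<dots> \<le> ln (real n) + (1 + 4 * real n powr \<alpha>) * 1"
    proof (rule add_mono[OF _ mult_mono])
      have kn: "2 ^ k \<le> real n" using k(1) by (metis of_nat_le_iff of_nat_numeral of_nat_power)
      then show "ln (2 ^ k) \<le> ln (real n)" by (intro ln_mono) simp_all
      have "(2 :: real) ^ h (Suc k) = 2 powr real (h (Suc k))" by (simp add: powr_realpow)
      also have "\<dots> \<le> 2 powr (\<alpha> * real (Suc k))"
        using h[of "Suc k"] by (intro powr_mono) linarith+
      also have "\<dots> = 2 powr \<alpha> * (2 ^ k) powr \<alpha>"
        unfolding powr_k by (simp add: powr_mult)
      also have "\<dots> \<le> 2 * real n powr \<alpha>"
        using assms kn powr_mono[of \<alpha> 1 2] by (intro mult_mono powr_mono2) auto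
      finally show "1 + 2 * 2 ^ h (Suc k) \<le> 1 + 4 * real n powr \<alpha>" by simp
      show "ln 2 \<le> (1 :: real)" using ln_le_minus_one[of 2] by simp
    qed auto
    finally show "ln (real (card (words X n))) \<le> 4 * real n powr \<alpha> + ln (real n) + 1" by simp
  qed (use assms in auto)
  then show ?thesis using is_subshift_X strictly_ergodic_X by blast
qed

end
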